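(* Let $M\ge1$ be an integer and let $(t_n)_{n\ge0}$ and $(i_n)_{n\ge0}$ be real sequences. Define $(c_n)_{n\ge0}$ by $c_n=i_n$ for $n\le M$ and \[ c_n=t_n+\frac{1}{\binom n2}\sum_{1\le p<q\le n}\bigl(c_{p-1}+c_{q-p-1}+c_{n-q}\bigr)\qquad(n>M). \] Then for all $n\ge M+3$, \[ c_n=\frac{1}{\binom n4}\sum_{i=M+4}^{n}\binom i4\sum_{j=M+2}^{i-2}\Bigl(t_{j+2}-\frac{2j}{j+2}t_{j+1}+\frac{\binom j2}{\binom{j+2}2}t_j\Bigr) +\Bigl(\frac{n+1}{5}+\frac{\binom{M+3}4-\binom{M+4}5}{\binom n4}\Bigr)c_{M+3} -\frac{M-1}{M+3}\Bigl(\frac{n+1}{5}-\frac{\binom{M+4}5}{\binom n4}\Bigr)c_{M+2}. \] In particular, $c_n$ depends linearly on the toll sequence.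
   Context: In the intended application, $c_n$ is the expected cost of Yaroslavskiy's dual-pivot Quicksort on a random permutation of size $n$, $t_n$ the expected cost of the first partitioning step, and $i_n$ the expected cost of the base-case sorting method on inputs of size $n\le M$. *)

theory Defs
  imports Complex_Main
begin

text \<open>
  Generalized dual-pivot Quicksort recurrence with toll sequence \<open>t\<close> and base-case
  costs \<open>b\<close> (the costs \<open>i\<^sub>n\<close>, of which only those with \<open>n \<le> M\<close> matter).
  The natural-number subtractions never truncate, as \<open>1 \<le> p < q \<le> n\<close>; and for
  \<open>M \<ge> 1\<close> the divisor \<open>n choose 2\<close> is nonzero in the recursive case.
\<close>

function dpq_cost :: "nat \<Rightarrow> (nat \<Rightarrow> real) \<Rightarrow> (nat \<Rightarrow> real) \<Rightarrow> nat \<Rightarrow> real" where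
  "dpq_cost M t b n =
    (if n \<le> M then b n
     else t n + 1 / real (n choose 2) *
       (\<Sum>p\<in>{1..n}. \<Sum>q\<in>{p<..n}.
          dpq_cost M t b (p - 1) + dpq_cost M t b (q - p - 1) + dpq_cost M t b (n - q)))"
  by pat_completeness auto
termination
  by (relation "measure (\<lambda>(M, t, b, n). n)") auto

declare dpq_cost.simps [simp del]

end

theory Submission
  imports Defs
begin

text \<open>
  By symmetry the recurrence reads \<open>(n choose 2) * (c n - t n) = 3 * (\<Sum>m<n. \<Sum>k<m. c k)\<close>, so
  taking second differences yields a three-term recurrence for \<open>c\<close>. The recurrence operator
  factors: \<open>D n = c (n+1) - (n-3)/(n+1) * c n\<close> satisfies \<open>D (n+1) = D n + \<tau> n\<close>, where
  \<open>\<tau>\<close> is the toll combination in the inner sum, and \<open>n choose 4\<close> is a summation factor for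
  the remaining first-order recurrence. Both telescope.
\<close>

text \<open>Each of the sizes \<open>p - 1\<close>, \<open>q - p - 1\<close> and
  \<open>n - q\<close> takes a value \<open>k < n\<close> for exactly \<open>n - 1 - k\<close> pairs
  of pivots. This is also the number of \<open>m\<close> with \<open>k < m < n\<close>, hence the
  nested sum, whose differences are easy to take.\<close>

lemma sum_pivot_pairs:
  fixes f :: "nat \<Rightarrow> 'a::comm_semiring_1"
  shows "(\<Sum>p\<in>{1..n}. \<Sum>q\<in>{p<..n}. f (p - 1) + f (q - p - 1) + f (n - q))
    = 3 * (\<Sum>m<n. \<Sum>k<m. f k)"
proof -
  have left: "(\<Sum>p\<in>{1..n}. \<Sum>q\<in>{p<..n}. f (p - 1)) = (\<Sum>m<n. \<Sum>k<m. f k)"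
  proof (induction n)
    case (Suc n)
    have "(\<Sum>p\<in>{1..Suc n}. \<Sum>q\<in>{p<..Suc n}. f (p - 1))
        = (\<Sum>p\<in>{1..n}. (\<Sum>q\<in>{p<..n}. f (p - 1)) + f (p - 1))"
      by (auto intro!: sum.cong simp: Suc_diff_le algebra_simps)
    moreover have "(\<Sum>p\<in>{1..n}. f (p - 1)) = (\<Sum>k<n. f k)"
      by (rule sum.reindex_bij_witness[of _ Suc "\<lambda>p. p - 1"]) auto
    ultimately show ?case
      using Suc by (simp add: sum.distrib)
  qed simp
  have middle: "(\<Sum>q\<in>{p<..n}. f (q - p - 1)) = (\<Sum>k<n-p. f k)" for p
    by (rule sum.reindex_bij_witness[of _ "\<lambda>k. k + p + 1" "\<lambda>q. q - p - 1"]) auto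
  have right: "(\<Sum>q\<in>{p<..n}. f (n - q)) = (\<Sum>k<n-p. f k)" for p
    by (rule sum.reindex_bij_witness[of _ "\<lambda>k. n - k" "\<lambda>q. n - q"]) auto
  have outer: "(\<Sum>p\<in>{1..n}. \<Sum>k<n-p. f k) = (\<Sum>m<n. \<Sum>k<m. f k)"
    by (rule sum.reindex_bij_witness[of _ "\<lambda>m. n - m" "\<lambda>p. n - p"]) auto
  have "3 * x = x + x + x" for x :: 'a
    using distrib_right[of 2 1 x] by (simp add: mult_2)
  then show ?thesis
    unfolding sum.distrib left middle right outer by simp
qed

lemma real_choose_two: "real (n choose 2) = real n * (real n - 1) / 2"
  by (simp add: binomial_gbinomial gbinomial_pochhammer' numeral_2_eq_2 pochhammer_Suc algebra_simps)

lemma dpq_cost_eq_sum: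
  assumes "M \<ge> 1" "n > M"
  shows "real (n choose 2) * (dpq_cost M t b n - t n)
    = 3 * (\<Sum>m<n. \<Sum>k<m. dpq_cost M t b k)"
proof -
  have "n choose 2 > 0"
    using assms by (simp add: zero_less_binomial_iff)
  then show ?thesis
    using assms unfolding dpq_cost.simps[of _ _ _ n] sum_pivot_pairs by simp
qed

text \<open>This is the second difference of \<open>real (j choose 2) * t j\<close>, divided by its
  leading coefficient \<open>(j+2) choose 2\<close>.\<close>

definition toll_diff :: "(nat \<Rightarrow> real) \<Rightarrow> nat \<Rightarrow> real" where
  "toll_diff t j = t (j+2) - 2 * real j / (real j + 2) * t (j+1)
     + real (j choose 2) / real ((j+2) choose 2) * t j"

text \<open>For \<open>n \<ge> 3\<close> the coefficient is the ratio of \<open>n choose 4\<close>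
  to \<open>(n+1) choose 4\<close>.\<close>

definition cost_diff :: "(nat \<Rightarrow> real) \<Rightarrow> nat \<Rightarrow> real" where
  "cost_diff c n = c (n+1) - (real n - 3) / (real n + 1) * c n"

text \<open>The factorization rests on \<open>n(n-1) - 6 = (n+2)(n-3)\<close> for the coefficient of
  \<open>c n\<close> and on \<open>2n(n+1) = (n+1)(n-2) + (n+2)(n+1)\<close> for that of
  \<open>c (n+1)\<close>.\<close>

lemma cost_diff_Suc:
  assumes "M \<ge> 1" "n > M"
  shows "cost_diff (dpq_cost M t b) (Suc n) = cost_diff (dpq_cost M t b) n + toll_diff t n"
proof -
  define c where "c = dpq_cost M t b"
  define s where "s n = 3 * (\<Sum>m<n. \<Sum>k<m. c k)" for n
  \<comment> \<open>Differencing twice undoes both summations.\<close>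
  have "s (n+2) - 2 * s (n+1) + s n = 3 * c n"
    by (simp add: s_def)
  moreover have "s m = real m * (real m - 1) / 2 * (c m - t m)" if "m > M" for m
    using dpq_cost_eq_sum[OF assms(1) that] by (simp add: c_def s_def real_choose_two)
  ultimately have
    "(real n + 2) * (real n + 1) * (c (n+2) - t (n+2)) - 2 * (real n + 1) * real n * (c (n+1) - t (n+1))
      + real n * (real n - 1) * (c n - t n) = 6 * c n"
    using assms by (simp add: field_simps)
  moreover have "(real n + 2) * (real n + 1) * toll_diff t n = (real n + 2) * (real n + 1) * t (n+2)
      - 2 * (real n + 1) * real n * t (n+1) + real n * (real n - 1) * t n"
    by (simp add: toll_diff_def real_choose_two divide_simps) (simp add: algebra_simps)
  moreover have "(real n + 2) * (real n + 1) * cost_diff c (Suc n)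
      = (real n + 2) * (real n + 1) * c (n+2) - (real n + 1) * (real n - 2) * c (n+1)"
    by (simp add: cost_diff_def divide_simps) (simp add: algebra_simps)
  moreover have "(real n + 2) * (real n + 1) * cost_diff c n
      = (real n + 2) * (real n + 1) * c (n+1) - (real n + 2) * (real n - 3) * c n"
    by (simp add: cost_diff_def divide_simps) (simp add: algebra_simps)
  ultimately have "(real n + 2) * (real n + 1) * cost_diff c (Suc n)
      = (real n + 2) * (real n + 1) * (cost_diff c n + toll_diff t n)"
    by (simp only: distrib_left) (simp add: algebra_simps)
  then show ?thesis
    unfolding c_def by (subst (asm) mult_cancel_left) (auto simp: add_eq_0_iff)
qed

lemma cost_diff_eq_sum:
  assumes "M \<ge> 1" "n \<ge> M + 2"
  shows "cost_diff (dpq_cost M t b) (Suc n)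
    = cost_diff (dpq_cost M t b) (M + 2) + (\<Sum>j=M+2..n. toll_diff t j)"
  using assms(2)
proof (induction n rule: dec_induct)
  case base
  then show ?case
    using cost_diff_Suc[OF assms(1), of "M + 2"] by simp
next
  case (step n)
  then show ?case
    using cost_diff_Suc[OF assms(1), of "Suc n"] by simp
qed

lemma choose_four_times_cost:
  assumes "n \<ge> 3"
  shows "real (Suc n choose 4) * c (Suc n)
    = real (Suc n choose 4) * cost_diff c n + real (n choose 4) * c n"
proof -
  \<comment> \<open>Absorption, with \<open>Suc n - 4 = n - 3\<close>; \<open>n \<ge> 3\<close>
    makes this agree with the real difference.\<close>
  have "real ((n - 3) * (Suc n choose 4)) = real (Suc n * (n choose 4))"
    using binomial_absorb_comp[of "Suc n" 4] by simp
  then have "(real n - 3) * real (Suc n choose 4) = (real n + 1) * real (n choose 4)"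
    using assms by (simp only: of_nat_mult) (simp add: of_nat_diff)
  then have "real (Suc n choose 4) * ((real n - 3) / (real n + 1)) = real (n choose 4)"
    by (simp add: field_simps)
  then show ?thesis
    by (simp only: cost_diff_def right_diff_distrib mult.assoc[symmetric] Suc_eq_plus1 diff_add_cancel)
qed

text \<open>Telescoping from \<open>M+3\<close>, the constant \<open>cost_diff c (M+2)\<close> is
  weighted by the sum of \<open>i choose 4\<close> over \<open>M+4 \<le> i \<le> n\<close>. The
  hockey-stick identity closes this sum to the difference of binomials.\<close>

lemma choose_four_cost_eq_sum:
  fixes t b :: "nat \<Rightarrow> real"
  assumes "M \<ge> 1" "n \<ge> M + 3"
  defines "c \<equiv> dpq_cost M t b"
  shows "real (n choose 4) * c n
    = (\<Sum>i=M+4..n. real (i choose 4) * (\<Sum>j=M+2..i-2. toll_diff t j))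
      + (real (Suc n choose 5) - real ((M+4) choose 5)) * cost_diff c (M+2)
      + real ((M+3) choose 4) * c (M+3)"
  using assms(2)
proof (induction n rule: dec_induct)
  case base
  then show ?case by (simp add: add.commute[of M])
next
  case (step n)
  \<comment> \<open>The new summand has index \<open>i = Suc n\<close>, so its inner sum stops at
    \<open>i - 2 = k\<close>, as does the sum for \<open>cost_diff c (Suc k)\<close>.\<close>
  obtain k where k: "n = Suc k" "k \<ge> M + 2"
    using step.hyps by (cases n) auto
  have "cost_diff c n = cost_diff c (M+2) + (\<Sum>j=M+2..k. toll_diff t j)"
    using cost_diff_eq_sum[OF assms(1) k(2)] by (simp add: c_def k)
  moreover have "Suc (Suc n) choose 5 = (Suc n choose 4) + (Suc n choose 5)"
    by (simp add: eval_nat_numeral)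
  moreover have "M + 4 \<le> Suc n" "Suc n - 2 = k"
    using k by auto
  ultimately show ?case
    using step choose_four_times_cost[of n c] k
    by (simp add: algebra_simps)
qed

text \<open>Tolls and base costs are combined together, since for fixed base costs the dependence on
  the tolls is in general only affine.\<close>

lemma dpq_cost_linear:
  "dpq_cost M (\<lambda>k. x * t1 k + y * t2 k) (\<lambda>k. x * b1 k + y * b2 k) n
    = x * dpq_cost M t1 b1 n + y * dpq_cost M t2 b2 n"
proof (induction n rule: less_induct)
  case (less n)
  let ?c = "dpq_cost M (\<lambda>k. x * t1 k + y * t2 k) (\<lambda>k. x * b1 k + y * b2 k)"
  have "(\<Sum>m<n. \<Sum>k<m. ?c k) = (\<Sum>m<n. \<Sum>k<m. x * dpq_cost M t1 b1 k + y * dpq_cost M t2 b2 k)"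
    using less by (intro sum.cong) auto
  also have "\<dots> = x * (\<Sum>m<n. \<Sum>k<m. dpq_cost M t1 b1 k) + y * (\<Sum>m<n. \<Sum>k<m. dpq_cost M t2 b2 k)"
    by (simp add: sum.distrib sum_distrib_left)
  finally show ?case
    unfolding dpq_cost.simps[of _ _ _ n] sum_pivot_pairs by (simp add: algebra_simps add_divide_distrib)
qed

theorem theorem3p1:
  fixes M :: nat and t b :: "nat \<Rightarrow> real"
  assumes "M \<ge> 1"
  defines "c \<equiv> dpq_cost M t b"
  shows "(\<forall>n\<ge>M+3. c n =
        1 / real (n choose 4) *
          (\<Sum>i=M+4..n. real (i choose 4) *
             (\<Sum>j=M+2..i-2. t (j+2) - 2 * real j / (real j + 2) * t (j+1)
                + real (j choose 2) / real ((j+2) choose 2) * t j))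
        + ((real n + 1) / 5
            + (real ((M+3) choose 4) - real ((M+4) choose 5)) / real (n choose 4)) * c (M+3)
        - (real M - 1) / (real M + 3)
            * ((real n + 1) / 5 - real ((M+4) choose 5) / real (n choose 4)) * c (M+2))
    \<and> (\<forall>(t1::nat \<Rightarrow> real) (t2::nat \<Rightarrow> real) (b1::nat \<Rightarrow> real) (b2::nat \<Rightarrow> real)
          (x::real) (y::real) n.
        dpq_cost M (\<lambda>k. x * t1 k + y * t2 k) (\<lambda>k. x * b1 k + y * b2 k) n
          = x * dpq_cost M t1 b1 n + y * dpq_cost M t2 b2 n)"
proof (intro conjI allI impI)
  fix n assume n: "n \<ge> M + 3"
  define S where "S = (\<Sum>i=M+4..n. real (i choose 4) * (\<Sum>j=M+2..i-2. toll_diff t j))"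
  have "n choose 4 > 0"
    using n assms(1) by (simp add: zero_less_binomial_iff)
  moreover define r where "r = (real M - 1) / (real M + 3)"
  \<comment> \<open>Absorption again: after division by \<open>n choose 4\<close> this binomial
    leaves the term \<open>(n+1)/5\<close>.\<close>
  have choose5: "real (Suc n choose 5) = (real n + 1) / 5 * real (n choose 4)"
    using Suc_times_binomial_eq[of n 4] by (simp add: field_simps flip: of_nat_mult of_nat_Suc)
  have diff: "cost_diff c (M+2) = c (M+3) - r * c (M+2)"
    by (simp add: cost_diff_def r_def eval_nat_numeral)
  have "real (n choose 4) * c n = S
      + ((real n + 1) / 5 * real (n choose 4) - real ((M+4) choose 5)) * (c (M+3) - r * c (M+2))
      + real ((M+3) choose 4) * c (M+3)"
    using choose_four_cost_eq_sum[OF assms(1) n, of t b, folded c_def S_def]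
    unfolding choose5 diff .
  ultimately have "c n = 1 / real (n choose 4) * S
      + ((real n + 1) / 5
          + (real ((M+3) choose 4) - real ((M+4) choose 5)) / real (n choose 4)) * c (M+3)
      - r * ((real n + 1) / 5 - real ((M+4) choose 5) / real (n choose 4)) * c (M+2)"
    by (simp add: divide_simps) (simp add: algebra_simps)
  then show "c n =
        1 / real (n choose 4) *
          (\<Sum>i=M+4..n. real (i choose 4) *
             (\<Sum>j=M+2..i-2. t (j+2) - 2 * real j / (real j + 2) * t (j+1)
                + real (j choose 2) / real ((j+2) choose 2) * t j))
        + ((real n + 1) / 5
            + (real ((M+3) choose 4) - real ((M+4) choose 5)) / real (n choose 4)) * c (M+3)
        - (real M - 1) / (real M + 3)
            * ((real n + 1) / 5 - real ((M+4) choose 5) / real (n choose 4)) * c (M+2)"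
    unfolding S_def toll_diff_def r_def .
qed (rule dpq_cost_linear)

end
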